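(* Let $\theta\ge p>1$, let $\alpha\ge 0$, $A>0$, and let $\rho:\mathbb{R}^N\to\mathbb{R}$ be a radial continuous function with $\rho(x)\ge A(1+|x|^2)^{\alpha/2}$ for all $x\in\mathbb{R}^N$. Let $(u,v)$ be a classical solution of $$-\Delta u=\rho(x)v^p,\qquad -\Delta v=\rho(x)u^\theta,\qquad u,v>0\quad\text{in }\mathbb{R}^N,$$ and assume that $u$ is bounded. Then $$v\le\|u\|_\infty^{\frac{\theta-p}{p+1}}\,u\quad\text{in }\mathbb{R}^N.$$
   Context: $\|u\|_\infty=\sup_{\mathbb{R}^N}|u|$. *)

theory Defs
  imports "HOL-Analysis.Analysis"
begin

definition partial_deriv :: "'n::finite \<Rightarrow> (real ^ 'n \<Rightarrow> real) \<Rightarrow> real ^ 'n \<Rightarrow> real" where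
  "partial_deriv i f x = frechet_derivative f (at x) (axis i 1)"

(* frechet_derivative is an unspecified choice where f is not differentiable, so
   differentiability is required explicitly alongside continuity of the partials. *)
definition C1 :: "(real ^ 'n::finite \<Rightarrow> real) \<Rightarrow> bool" where
  "C1 f \<longleftrightarrow> (\<forall>x. f differentiable (at x)) \<and> (\<forall>i. continuous_on UNIV (partial_deriv i f))"

definition C2 :: "(real ^ 'n::finite \<Rightarrow> real) \<Rightarrow> bool" where
  "C2 f \<longleftrightarrow> C1 f \<and> (\<forall>i. C1 (partial_deriv i f))"

definition laplacian :: "(real ^ 'n::finite \<Rightarrow> real) \<Rightarrow> real ^ 'n \<Rightarrow> real" where
  "laplacian f x = (\<Sum>i\<in>UNIV. partial_deriv i (partial_deriv i f) x)"

definition radial :: "(real ^ 'n::finite \<Rightarrow> real) \<Rightarrow> bool" where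
  "radial f \<longleftrightarrow> (\<exists>g. \<forall>x. f x = g (norm x))"

(* A real-valued supremum: meaningful only for bounded u. *)
definition sup_norm :: "(real ^ 'n::finite \<Rightarrow> real) \<Rightarrow> real" where
  "sup_norm u = (SUP x. \<bar>u x\<bar>)"

(* powr at non-positive bases does not matter: u and v are required to be positive. *)
definition classical_positive_solution ::
  "(real ^ 'n::finite \<Rightarrow> real) \<Rightarrow> real \<Rightarrow> real \<Rightarrow> (real ^ 'n \<Rightarrow> real) \<Rightarrow> (real ^ 'n \<Rightarrow> real) \<Rightarrow> bool"
where
  "classical_positive_solution \<rho> p \<theta> u v \<longleftrightarrow>
     C2 u \<and> C2 v \<and>
     (\<forall>x. - laplacian u x = \<rho> x * v x powr p) \<and>
     (\<forall>x. - laplacian v x = \<rho> x * u x powr \<theta>) \<and>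
     (\<forall>x. u x > 0) \<and> (\<forall>x. v x > 0)"

end

theory Submission imports Defs
begin

text \<open>
  Write \<open>S\<close> for the supremum of \<open>u\<close> and \<open>l = S powr ((\<theta> - p) / (p + 1))\<close>, so that
  \<open>l powr (p + 1) = S powr (\<theta> - p)\<close>. For the difference \<open>w = v - l u\<close> one has
  \<open>\<Delta>w = \<rho> (l v powr p - u powr \<theta>)\<close>, and \<open>u powr \<theta> \<le> S powr (\<theta> - p) * u powr p = l (l u) powr p\<close>.
  Hence, wherever \<open>w > 0\<close>, superadditivity of \<open>t powr p\<close> gives
  \<open>\<Delta>w \<ge> \<rho> l (v powr p - (l u) powr p) \<ge> A l w powr p\<close>, because \<open>\<rho> \<ge> A\<close>.

  An entire function with this property is nowhere positive, by the Keller--Osserman argument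
  (\<open>keller_osserman\<close>): the superlinear inequality bounds \<open>w\<close> in the ball of radius \<open>R\<close> about \<open>z\<close> by
  a multiple of the barrier \<open>(R\<^sup>2 - \<bar>x - z\<bar>\<^sup>2) powr (- \<beta>)\<close> with \<open>\<beta> = 2 / (p - 1)\<close>, whatever the
  values of \<open>w\<close> on the boundary, and the resulting bound on \<open>w z\<close> tends to \<open>0\<close> as \<open>R\<close> grows.
  The comparison with the barrier (\<open>laplacian_le_of_touching_barrier\<close>) is the second derivative
  test, applied along each coordinate direction at a point where the barrier touches \<open>w\<close> from above.
\<close>

section \<open>Partial derivatives and the Laplacian\<close>

lemma partial_deriv_eqI:
  assumes "(f has_derivative f') (at x)"
  shows "partial_deriv i f x = f' (axis i 1)"
  using frechet_derivative_at[OF assms] by (simp add: partial_deriv_def)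

lemma partial_deriv_diff_scale:
  fixes f g :: "real ^ 'n::finite \<Rightarrow> real"
  assumes "f differentiable (at x)" "g differentiable (at x)"
  shows "partial_deriv i (\<lambda>y. f y - c * g y) x = partial_deriv i f x - c * partial_deriv i g x"
proof -
  have "((\<lambda>y. f y - c * g y) has_derivative
      (\<lambda>h. frechet_derivative f (at x) h - c * frechet_derivative g (at x) h)) (at x)"
    using assms by (intro derivative_intros) (simp_all add: frechet_derivative_works)
  from partial_deriv_eqI[OF this] show ?thesis by (simp add: partial_deriv_def)
qed

lemma C1_diff_scale:
  assumes "C1 f" "C1 g"
  shows "C1 (\<lambda>x. f x - c * g x)"
    and "partial_deriv i (\<lambda>x. f x - c * g x) = (\<lambda>x. partial_deriv i f x - c * partial_deriv i g x)"
proof -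
  show eq: "partial_deriv i (\<lambda>x. f x - c * g x) =
      (\<lambda>x. partial_deriv i f x - c * partial_deriv i g x)" for i
    using assms by (auto simp: C1_def partial_deriv_diff_scale)
  show "C1 (\<lambda>x. f x - c * g x)"
    using assms unfolding C1_def eq
    by (auto intro!: derivative_intros continuous_intros differentiable_diff differentiable_mult)
qed

lemma C2_diff_scale:
  assumes "C2 f" "C2 g"
  shows "C2 (\<lambda>x. f x - c * g x)"
  using assms unfolding C2_def by (auto simp: C1_diff_scale)

lemma laplacian_diff_scale:
  assumes "C2 f" "C2 g"
  shows "laplacian (\<lambda>x. f x - c * g x) x = laplacian f x - c * laplacian g x"
  using assms unfolding C2_def laplacian_def
  by (simp add: C1_diff_scale sum_subtractf sum_distrib_left)

lemma has_real_derivative_along_axis: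
  fixes f :: "real ^ 'n::finite \<Rightarrow> real"
  assumes "f differentiable (at (x + t *\<^sub>R axis i 1))"
  shows "((\<lambda>s. f (x + s *\<^sub>R axis i 1)) has_real_derivative
           partial_deriv i f (x + t *\<^sub>R axis i 1)) (at t)"
proof -
  let ?F = "frechet_derivative f (at (x + t *\<^sub>R axis i 1))"
  have F: "(f has_derivative ?F) (at (x + t *\<^sub>R axis i 1))"
    using assms frechet_derivative_works by blast
  have "((\<lambda>s. x + s *\<^sub>R axis i 1) has_derivative (\<lambda>s. s *\<^sub>R axis i 1)) (at t)"
    by (auto intro!: derivative_eq_intros)
  from diff_chain_at[OF this F]
  have "((\<lambda>s. f (x + s *\<^sub>R axis i 1)) has_derivative (\<lambda>s. ?F (s *\<^sub>R axis i 1))) (at t)"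
    by (simp add: o_def)
  moreover have "?F (s *\<^sub>R axis i 1) = partial_deriv i f (x + t *\<^sub>R axis i 1) * s" for s
    using linear_cmul[OF has_derivative_linear[OF F]] by (simp add: partial_deriv_def)
  ultimately show ?thesis
    by (simp add: has_field_derivative_def)
qed

section \<open>Touching the barrier from below\<close>

text \<open>
  A positive second derivative would make the first derivative, which vanishes at the maximum,
  positive just to the right of it, so that \<open>h\<close> would increase there.
\<close>

lemma second_derivative_nonpos_at_max:
  fixes h h' :: "real \<Rightarrow> real"
  assumes d: "d > 0" and h: "\<And>t. \<bar>t\<bar> < d \<Longrightarrow> (h has_real_derivative h' t) (at t)"
    and h': "(h' has_real_derivative D) (at 0)" and max: "\<And>t. \<bar>t\<bar> < d \<Longrightarrow> h t \<le> h 0"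
  shows "D \<le> 0"
proof (rule ccontr)
  assume "\<not> D \<le> 0"
  have "h' 0 = 0"
    using DERIV_local_max[OF h[of 0] d] d max by auto
  with DERIV_pos_inc_right[OF h'] \<open>\<not> D \<le> 0\<close> obtain e
    where e: "e > 0" "\<And>t. 0 < t \<Longrightarrow> t < e \<Longrightarrow> h' t > 0"
    by auto
  define s where "s = min d e / 2"
  have s: "0 < s" "s < d" "s < e" using d e by (auto simp: s_def)
  obtain t where t: "0 < t" "t < s" "h s - h 0 = (s - 0) * h' t"
    using MVT2[of 0 s h h'] s h by auto
  have "h' t > 0" using e t s by auto
  with s have "0 < s * h' t" by simp
  with t have "h s > h 0" by simp
  with max[of s] s show False by simp
qed

text \<open>
  Along every coordinate line through \<open>x\<close> the difference of \<open>w\<close> and the barrier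
  \<open>M (R\<^sup>2 - \<bar>y - z\<bar>\<^sup>2) powr (- \<beta>)\<close> has a maximum at \<open>x\<close>, so each pure second derivative of \<open>w\<close> is at
  most that of the barrier, and summing bounds the Laplacian. The right-hand side is the
  Laplacian of the barrier at \<open>x\<close>, with the equal value \<open>w x\<close> factored out so that \<open>M\<close> disappears.
\<close>

lemma laplacian_le_of_touching_barrier:
  fixes w :: "real ^ 'n::finite \<Rightarrow> real"
  assumes w: "C2 w" and x: "dist z x < R"
    and touch: "w x = M * (R\<^sup>2 - (norm (x - z))\<^sup>2) powr (- \<beta>)"
    and below: "\<And>y. dist z y < R \<Longrightarrow> w y \<le> M * (R\<^sup>2 - (norm (y - z))\<^sup>2) powr (- \<beta>)"
  defines "a \<equiv> R\<^sup>2 - (norm (x - z))\<^sup>2"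
  shows "laplacian w x \<le>
    w x * (4 * \<beta> * (\<beta> + 1) * (norm (x - z))\<^sup>2 + 2 * real CARD('n) * \<beta> * a) / a\<^sup>2"
proof -
  have a: "a > 0"
    using x by (simp add: a_def dist_norm norm_minus_commute power_strict_mono)
  have D2: "partial_deriv i (partial_deriv i w) x \<le>
      w x / a\<^sup>2 * (4 * \<beta> * (\<beta> + 1) * ((x - z) $ i)\<^sup>2 + 2 * \<beta> * a)" for i
  proof -
    \<comment> \<open>The base of the barrier restricted to the line is the quadratic \<open>g\<close> (fact \<open>g\<close> below).\<close>
    define b where "b = (x - z) $ i"
    define g where "g = (\<lambda>t. a - 2 * b * t - t\<^sup>2)"
    define y where "y = (\<lambda>t. x + t *\<^sub>R axis i (1::real))"
    have g: "R\<^sup>2 - (norm (y t - z))\<^sup>2 = g t" for t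
    proof -
      have "(norm (y t - z))\<^sup>2 = (norm ((x - z) + t *\<^sub>R axis i 1))\<^sup>2"
        by (simp add: y_def algebra_simps)
      also have "\<dots> = (norm (x - z))\<^sup>2 + 2 * t * b + t\<^sup>2"
        unfolding power2_norm_eq_inner b_def
        by (simp add: inner_add_left inner_add_right inner_axis inner_axis_axis
            inner_commute[of "axis i 1"] power2_eq_square algebra_simps)
      finally show ?thesis by (simp add: g_def a_def)
    qed
    define d where "d = R - dist z x"
    have d: "d > 0" using x by (simp add: d_def)
    have inside: "dist z (y t) < R" if "\<bar>t\<bar> < d" for t
    proof -
      have "dist z (y t) \<le> dist z x + dist x (y t)" by (rule dist_triangle)
      also have "dist x (y t) = \<bar>t\<bar>" by (simp add: y_def dist_norm)
      finally show ?thesis using that by (simp add: d_def)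
    qed
    have gpos: "g t > 0" if "\<bar>t\<bar> < d" for t
      using inside[OF that] g[of t]
      by (metis diff_gt_0_iff_gt dist_commute dist_norm norm_ge_zero pos2 power_strict_mono)
    have dw: "((\<lambda>t. w (y t)) has_real_derivative partial_deriv i w (y t)) (at t)" for t
      unfolding y_def using w by (intro has_real_derivative_along_axis) (simp add: C2_def C1_def)
    have ddw: "((\<lambda>t. partial_deriv i w (y t)) has_real_derivative
        partial_deriv i (partial_deriv i w) (y t)) (at t)" for t
      unfolding y_def using w by (intro has_real_derivative_along_axis) (simp add: C2_def C1_def)
    define h where "h = (\<lambda>t. w (y t) - M * g t powr (- \<beta>))"
    define h' where
      "h' = (\<lambda>t. partial_deriv i w (y t) - M * \<beta> * (2 * b + 2 * t) * g t powr (- \<beta> - 1))"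
    have dg: "(g has_real_derivative - (2 * b + 2 * t)) (at t)" for t
      unfolding g_def by (auto intro!: derivative_eq_intros)
    have dpow: "((\<lambda>t. g t powr s) has_real_derivative
        - (s * g t powr (s - 1) * (2 * b + 2 * t))) (at t)" if "\<bar>t\<bar> < d" for t s
      by (rule DERIV_cong[OF DERIV_chain2[OF has_real_derivative_powr[OF gpos[OF that]] dg]])
        (simp add: algebra_simps)
    have dh: "(h has_real_derivative h' t) (at t)" if "\<bar>t\<bar> < d" for t
      unfolding h_def h'_def
      by (rule DERIV_cong[OF DERIV_diff[OF dw DERIV_cmult[OF dpow[OF that]]]])
        (simp add: algebra_simps)
    have g0: "g 0 = a" and y0: "y 0 = x" by (simp_all add: g_def y_def)
    have ddh: "(h' has_real_derivative partial_deriv i (partial_deriv i w) x -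
        M * \<beta> * (2 * a powr (- \<beta> - 1) + 2 * b * ((\<beta> + 1) * a powr (- \<beta> - 2) * (2 * b)))) (at 0)"
      unfolding h'_def using a
      by (auto intro!: derivative_eq_intros ddw dg simp: g0 y0 algebra_simps)
    have hmax: "h t \<le> h 0" if "\<bar>t\<bar> < d" for t
      using below[OF inside[OF that]] touch by (simp add: h_def g g0 y0 flip: a_def)
    have "partial_deriv i (partial_deriv i w) x \<le>
        M * \<beta> * (2 * a powr (- \<beta> - 1) + 2 * b * ((\<beta> + 1) * a powr (- \<beta> - 2) * (2 * b)))"
      using second_derivative_nonpos_at_max[OF d dh ddh hmax] by simp
    also have "a powr (- \<beta> - 1) = a powr (- \<beta>) / a"
      using a by (simp add: powr_diff)
    also have "a powr (- \<beta> - 2) = a powr (- \<beta>) / a\<^sup>2"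
      using a by (simp add: powr_diff powr_numeral)
    also have "M * \<beta> * (2 * (a powr (- \<beta>) / a) +
          2 * b * ((\<beta> + 1) * (a powr (- \<beta>) / a\<^sup>2) * (2 * b))) =
        w x / a\<^sup>2 * (4 * \<beta> * (\<beta> + 1) * b\<^sup>2 + 2 * \<beta> * a)"
      using a unfolding touch a_def[symmetric] by (simp add: field_simps power2_eq_square)
    finally show ?thesis by (simp add: b_def)
  qed
  have "laplacian w x \<le>
      (\<Sum>i\<in>UNIV. w x / a\<^sup>2 * (4 * \<beta> * (\<beta> + 1) * ((x - z) $ i)\<^sup>2 + 2 * \<beta> * a))"
    unfolding laplacian_def by (rule sum_mono) (rule D2)
  also have "\<dots> = w x / a\<^sup>2 *
      (4 * \<beta> * (\<beta> + 1) * (\<Sum>i\<in>UNIV. ((x - z) $ i)\<^sup>2) + real CARD('n) * (2 * \<beta> * a))"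
    by (simp only: sum.distrib sum_constant flip: sum_distrib_left)
  also have "(\<Sum>i\<in>UNIV. ((x - z) $ i)\<^sup>2) = (norm (x - z))\<^sup>2"
    unfolding power2_norm_eq_inner by (simp add: inner_vec_def power2_eq_square)
  finally show ?thesis by (simp add: algebra_simps add_divide_distrib)
qed

section \<open>Entire solutions of the Keller--Osserman inequality\<close>

text \<open>
  Maximise \<open>F y = w y * (R\<^sup>2 - \<bar>y - z\<bar>\<^sup>2) powr \<beta>\<close> over the closed ball. The maximum is attained in the
  interior, where a multiple of the barrier touches \<open>w\<close>. The choice \<open>\<beta> = 2 / (p - 1)\<close>
  turns \<open>a\<^sup>2 * w x powr (p - 1)\<close> into \<open>F x powr (p - 1)\<close>, so the inequality at the touching point
  bounds the maximum of \<open>F\<close>, hence its value at the centre.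
\<close>

lemma keller_osserman_bound:
  fixes w :: "real ^ 'n::finite \<Rightarrow> real"
  assumes w: "C2 w" and p: "p > 1" and c: "c > 0"
    and ineq: "\<And>x. w x > 0 \<Longrightarrow> laplacian w x \<ge> c * w x powr p"
    and z: "w z > 0" and R: "R > 0"
  defines "\<beta> \<equiv> 2 / (p - 1)"
  shows "c * w z powr (p - 1) * R\<^sup>2 \<le> 4 * \<beta> * (\<beta> + 1) + 2 * real CARD('n) * \<beta>"
proof -
  have \<beta>: "\<beta> > 0" "\<beta> * (p - 1) = 2" using p by (simp_all add: \<beta>_def field_simps)
  define g where "g = (\<lambda>y. R\<^sup>2 - (norm (y - z))\<^sup>2)"
  have g_eq: "R\<^sup>2 - (norm (y - z))\<^sup>2 = g y" for y by (simp add: g_def)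
  define F where "F = (\<lambda>y. w y * g y powr \<beta>)"
  define K where "K = 4 * \<beta> * (\<beta> + 1) + 2 * real CARD('n) * \<beta>"
  have g_nonneg: "g y \<ge> 0" if "y \<in> cball z R" for y
    using that by (simp add: g_def dist_norm norm_minus_commute power_mono)
  have g_pos: "g y > 0" if "dist z y < R" for y
    using that by (simp add: g_def dist_norm norm_minus_commute power_strict_mono)
  have "continuous_on (cball z R) w"
    using w by (intro differentiable_imp_continuous_on)
      (auto simp: C2_def C1_def differentiable_on_def intro: differentiable_at_withinI)
  then have "continuous_on (cball z R) F"
    unfolding F_def using \<beta> g_nonneg
    by (intro continuous_on_mult continuous_on_powr') (auto simp: g_def intro!: continuous_intros)
  then obtain x where x: "x \<in> cball z R" and max: "\<And>y. y \<in> cball z R \<Longrightarrow> F y \<le> F x"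
    using continuous_attains_sup[OF compact_cball] R by (metis cball_eq_empty less_imp_le not_less)
  have Fz: "F z = w z * (R\<^sup>2) powr \<beta>" by (simp add: F_def g_def)
  have Fzpos: "F z > 0" using z R by (simp add: Fz)
  have FzFx: "F z \<le> F x" using max[of z] R by simp
  have "w x * g x powr \<beta> > 0" using Fzpos FzFx by (simp add: F_def)
  then have gx: "g x > 0" and wx: "w x > 0"
    using g_nonneg[OF x] by (auto simp: zero_less_mult_iff)
  have xR: "dist z x < R"
    using gx x R by (auto simp: g_def dist_norm norm_minus_commute less_le)
  have "laplacian w x \<le> w x *
      (4 * \<beta> * (\<beta> + 1) * (norm (x - z))\<^sup>2 + 2 * real CARD('n) * \<beta> * g x) / (g x)\<^sup>2"
    unfolding g_def
  proof (rule laplacian_le_of_touching_barrier[OF w xR, where M = "F x"])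
    show "w x = F x * (R\<^sup>2 - (norm (x - z))\<^sup>2) powr (- \<beta>)"
      using gx by (simp add: F_def powr_minus g_eq)
    show "w y \<le> F x * (R\<^sup>2 - (norm (y - z))\<^sup>2) powr (- \<beta>)" if "dist z y < R" for y
      using max[of y] that g_pos[OF that]
      by (simp add: F_def g_eq powr_minus field_simps)
  qed
  also have "\<dots> \<le> w x * (K * R\<^sup>2) / (g x)\<^sup>2"
  proof (intro divide_right_mono mult_left_mono)
    have "(norm (x - z))\<^sup>2 \<le> R\<^sup>2" "g x \<le> R\<^sup>2" using gx by (simp_all add: g_def)
    then have "4 * \<beta> * (\<beta> + 1) * (norm (x - z))\<^sup>2 + 2 * real CARD('n) * \<beta> * g x
        \<le> 4 * \<beta> * (\<beta> + 1) * R\<^sup>2 + 2 * real CARD('n) * \<beta> * R\<^sup>2"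
      using \<beta> by (intro add_mono mult_left_mono) auto
    then show "4 * \<beta> * (\<beta> + 1) * (norm (x - z))\<^sup>2 + 2 * real CARD('n) * \<beta> * g x \<le> K * R\<^sup>2"
      by (simp add: K_def distrib_right)
  qed (use wx in auto)
  finally have "c * w x powr p \<le> w x * (K * R\<^sup>2) / (g x)\<^sup>2"
    using ineq[OF wx] by linarith
  moreover have "w x powr p = w x * w x powr (p - 1)"
    using wx by (simp add: powr_mult_base)
  ultimately have "w x * (c * (w x powr (p - 1) * (g x)\<^sup>2)) \<le> w x * (K * R\<^sup>2)"
    using gx by (simp add: field_simps)
  then have bound: "c * (w x powr (p - 1) * (g x)\<^sup>2) \<le> K * R\<^sup>2"
    using wx mult_le_cancel_left_pos by blast
  have "w z powr (p - 1) * (R\<^sup>2)\<^sup>2 = F z powr (p - 1)"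
    using z R \<beta> by (simp add: Fz powr_mult powr_powr powr_numeral)
  also have "\<dots> \<le> F x powr (p - 1)"
    using FzFx Fzpos p by (intro powr_mono2) auto
  also have "\<dots> = w x powr (p - 1) * (g x)\<^sup>2"
    using wx gx \<beta> by (simp add: F_def powr_mult powr_powr powr_numeral)
  finally have "c * (w z powr (p - 1) * (R\<^sup>2)\<^sup>2) \<le> K * R\<^sup>2"
    using bound mult_left_mono[OF _ less_imp_le[OF c]] order_trans by blast
  then have "(c * w z powr (p - 1) * R\<^sup>2) * R\<^sup>2 \<le> K * R\<^sup>2"
    by (simp add: power2_eq_square mult_ac)
  then show ?thesis using R by (simp add: K_def)
qed

text \<open>The bound holds for every radius \<open>R\<close>, while its right-hand side does not depend on \<open>R\<close>.\<close>

lemma keller_osserman: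
  fixes w :: "real ^ 'n::finite \<Rightarrow> real"
  assumes "C2 w" "p > 1" "c > 0" "\<And>x. w x > 0 \<Longrightarrow> laplacian w x \<ge> c * w x powr p"
  shows "w z \<le> 0"
proof (rule ccontr)
  assume "\<not> w z \<le> 0"
  define \<beta> where "\<beta> = 2 / (p - 1)"
  define K where "K = 4 * \<beta> * (\<beta> + 1) + 2 * real CARD('n) * \<beta>"
  define q where "q = c * w z powr (p - 1)"
  have "\<beta> > 0" "q > 0" using assms(2,3) \<open>\<not> w z \<le> 0\<close> by (simp_all add: \<beta>_def q_def)
  then have K: "K > 0" by (auto simp: K_def intro!: add_pos_pos mult_pos_pos)
  \<comment> \<open>This radius makes the left-hand side of the bound equal to \<open>K + 1\<close>.\<close>
  define R where "R = sqrt ((K + 1) / q)"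
  have "R > 0" "q * R\<^sup>2 = K + 1" using K \<open>q > 0\<close> by (simp_all add: R_def)
  with keller_osserman_bound[OF assms, of z R] \<open>\<not> w z \<le> 0\<close> show False
    by (simp add: q_def K_def \<beta>_def)
qed

section \<open>Comparison of the two components\<close>

text \<open>
  Splitting off one factor, \<open>a powr p = a * a powr (p - 1) \<le> a * (a + b) powr (p - 1)\<close>, and likewise
  for \<open>b\<close>.
\<close>

lemma powr_add_superadditive:
  fixes a b p :: real
  assumes "a > 0" "b > 0" "p \<ge> 1"
  shows "a powr p + b powr p \<le> (a + b) powr p"
proof -
  have "a * a powr (p - 1) + b * b powr (p - 1) \<le> a * (a + b) powr (p - 1) + b * (a + b) powr (p - 1)"
    using assms by (intro add_mono mult_left_mono powr_mono2) auto
  also have "\<dots> = (a + b) * (a + b) powr (p - 1)"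
    by (simp add: distrib_right)
  finally show ?thesis using assms by (simp add: powr_mult_base)
qed

theorem proposition1p1:
  fixes p \<theta> \<alpha> A :: real
    and \<rho> u v :: "real ^ 'n::finite \<Rightarrow> real"
  assumes "\<theta> \<ge> p" and "p > 1"
    and "\<alpha> \<ge> 0" and "A > 0"
    and "radial \<rho>" and "continuous_on UNIV \<rho>"
    and "\<And>x. \<rho> x \<ge> A * (1 + (norm x)\<^sup>2) powr (\<alpha> / 2)"
    and "classical_positive_solution \<rho> p \<theta> u v"
    and "bounded (range u)"
  shows "\<forall>x. v x \<le> sup_norm u powr ((\<theta> - p) / (p + 1)) * u x"
proof
  fix x0
  define S where "S = sup_norm u"
  define l where "l = S powr ((\<theta> - p) / (p + 1))"
  define w where "w = (\<lambda>x. v x - l * u x)"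
  have C2: "C2 u" "C2 v" and lap_u: "\<And>x. laplacian u x = - (\<rho> x * v x powr p)"
    and lap_v: "\<And>x. laplacian v x = - (\<rho> x * u x powr \<theta>)"
    and pos: "\<And>x. u x > 0" "\<And>x. v x > 0"
    using assms(8) unfolding classical_positive_solution_def by (simp_all, (metis minus_minus)+)
  have uS: "u x \<le> S" for x
  proof -
    have "bdd_above (range (\<lambda>x. \<bar>u x\<bar>))"
      using \<open>bounded (range u)\<close> unfolding bounded_iff bdd_above_def by auto
    then have "\<bar>u x\<bar> \<le> S"
      unfolding S_def sup_norm_def by (rule cSUP_upper[OF UNIV_I])
    then show ?thesis by simp
  qed
  have S: "S > 0" using uS[of x0] pos(1)[of x0] by simp
  then have l: "l > 0" by (simp add: l_def)
  have \<rho>A: "\<rho> x \<ge> A" for x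
  proof -
    have "A * 1 \<le> A * (1 + (norm x)\<^sup>2) powr (\<alpha> / 2)"
      using \<open>A > 0\<close> \<open>\<alpha> \<ge> 0\<close> by (intro mult_left_mono ge_one_powr_ge_zero) auto
    then show ?thesis using assms(7)[of x] by simp
  qed
  have "laplacian w x \<ge> (A * l) * w x powr p" if wx: "w x > 0" for x
  proof -
    have "u x powr \<theta> = u x powr (\<theta> - p) * u x powr p"
      by (simp flip: powr_add)
    also have "\<dots> \<le> S powr (\<theta> - p) * u x powr p"
      using uS[of x] pos(1)[of x] \<open>\<theta> \<ge> p\<close> by (intro mult_right_mono powr_mono2) auto
    also have "S powr (\<theta> - p) = l powr (p + 1)"
      using \<open>p > 1\<close> by (simp add: l_def powr_powr)
    also have "l powr (p + 1) * u x powr p = l * (l * u x) powr p"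
      using l pos(1)[of x] by (simp add: powr_add powr_mult)
    finally have le: "u x powr \<theta> \<le> l * (l * u x) powr p" .
    have "w x powr p + (l * u x) powr p \<le> (w x + l * u x) powr p"
      using wx l pos(1)[of x] \<open>p > 1\<close> by (intro powr_add_superadditive) auto
    then have "l * (w x powr p + (l * u x) powr p) \<le> l * v x powr p"
      using l by (intro mult_left_mono) (auto simp: w_def)
    then have diff: "l * w x powr p \<le> l * v x powr p - u x powr \<theta>"
      using le by (simp add: distrib_left)
    have "A * (l * w x powr p) \<le> \<rho> x * (l * w x powr p)"
      using \<rho>A[of x] l by (intro mult_right_mono) auto
    also have "\<dots> \<le> \<rho> x * (l * v x powr p - u x powr \<theta>)"
      using diff \<rho>A[of x] \<open>A > 0\<close> by (intro mult_left_mono) auto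
    also have "\<dots> = laplacian w x"
      unfolding w_def laplacian_diff_scale[OF C2(2,1)] lap_u lap_v by (simp add: algebra_simps)
    finally show ?thesis by (simp add: mult.assoc)
  qed
  moreover have "C2 w" unfolding w_def by (rule C2_diff_scale[OF C2(2,1)])
  ultimately have "w x0 \<le> 0"
    using keller_osserman[of w p "A * l"] \<open>p > 1\<close> \<open>A > 0\<close> l by simp
  then show "v x0 \<le> sup_norm u powr ((\<theta> - p) / (p + 1)) * u x0"
    by (simp add: w_def l_def S_def)
qed

end
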